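(* Let $L_2$ be the free Lie algebra generated by $x,y$ over a field $K$ of characteristic zero, and let $\xi$ be an automorphism of $L_2$ which maps the algebra $L_2^{S_2}$ of symmetric polynomials into itself (i.e. $\xi\in\mathrm{Aut}(L_2^{S_2})$). Then there exist $a,b\in K$ with $c:=a^2-b^2\neq 0$ such that \[\xi(x)=ax+by,\quad \xi(y)=bx+ay,\] \[\xi^{-1}(x)=c^{-1}ax-c^{-1}by,\quad \xi^{-1}(y)=-c^{-1}bx+c^{-1}ay.\]
   Context: The symmetric group $S_2$ acts on $L_2$ by swapping $x$ and $y$; an element $p(x,y)$ is symmetric if $p(x,y)=p(y,x)$, and $L_2^{S_2}$ is the algebra of symmetric elements. *)

theory Defs
  imports Main
begin

text \<open>Free associative algebra K<x,y> realised as coefficient functions on words over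
the alphabet {x,y}; the letter x is True, the letter y is False.  The free Lie algebra L_2
is realised (Friedrichs/Witt) as the Lie subalgebra of K<x,y> generated by x and y under
the commutator bracket.\<close>

type_synonym 'a ncp = "bool list \<Rightarrow> 'a"

definition ncX :: "'a::field ncp" where
  "ncX = (\<lambda>w. if w = [True] then 1 else 0)"

definition ncY :: "'a::field ncp" where
  "ncY = (\<lambda>w. if w = [False] then 1 else 0)"

definition ncadd :: "'a::field ncp \<Rightarrow> 'a ncp \<Rightarrow> 'a ncp" where
  "ncadd p q = (\<lambda>w. p w + q w)"

definition ncsmul :: "'a::field \<Rightarrow> 'a ncp \<Rightarrow> 'a ncp" where
  "ncsmul c p = (\<lambda>w. c * p w)"

definition ncmul :: "'a::field ncp \<Rightarrow> 'a ncp \<Rightarrow> 'a ncp" where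
  "ncmul p q = (\<lambda>w. \<Sum>i\<le>length w. p (take i w) * q (drop i w))"

definition ncbr :: "'a::field ncp \<Rightarrow> 'a ncp \<Rightarrow> 'a ncp" where
  "ncbr p q = (\<lambda>w. ncmul p q w - ncmul q p w)"

inductive_set L2 :: "'a::field ncp set" where
  gen_x: "ncX \<in> L2"
| gen_y: "ncY \<in> L2"
| add: "p \<in> L2 \<Longrightarrow> q \<in> L2 \<Longrightarrow> ncadd p q \<in> L2"
| smul: "p \<in> L2 \<Longrightarrow> ncsmul c p \<in> L2"
| br: "p \<in> L2 \<Longrightarrow> q \<in> L2 \<Longrightarrow> ncbr p q \<in> L2"

definition ncswap :: "'a::field ncp \<Rightarrow> 'a ncp" where
  "ncswap p = (\<lambda>w. p (map Not w))"

definition symmetric_L2 :: "'a::field ncp set" where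
  "symmetric_L2 = {p \<in> L2. ncswap p = p}"

definition lie_aut_L2 :: "('a::field ncp \<Rightarrow> 'a ncp) \<Rightarrow> bool" where
  "lie_aut_L2 \<xi> \<longleftrightarrow> bij_betw \<xi> L2 L2
     \<and> (\<forall>p\<in>L2. \<forall>q\<in>L2. \<xi> (ncadd p q) = ncadd (\<xi> p) (\<xi> q))
     \<and> (\<forall>c. \<forall>p\<in>L2. \<xi> (ncsmul c p) = ncsmul c (\<xi> p))
     \<and> (\<forall>p\<in>L2. \<forall>q\<in>L2. \<xi> (ncbr p q) = ncbr (\<xi> p) (\<xi> q))"

end

theory Submission
  imports Defs
begin

text \<open>The pair \<open>f = \<xi> x\<close>, \<open>g = \<xi> y\<close> consists of Lie elements with \<open>x, y \<in> fA + gA\<close>, where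
\<open>A = K<x,y>\<close>.  If one of them has degree at least two, comparing top degrees in \<open>x = fa + gb\<close>,
\<open>y = fc + gd\<close> yields a relation between the leading forms, so one leading form is a right multiple
\<open>f' = g'h\<close> of the other.  As \<open>f'\<close> and \<open>g'\<close> are primitive for the shuffle coproduct, \<open>h\<close> is a
scalar: otherwise one can split off one left factor \<open>g'\<close> after the other, and primitivity fails
for \<open>c g'^j\<close> with \<open>j \<ge> 2\<close> in characteristic zero.  Subtracting a multiple of \<open>g\<close> from \<open>f\<close> then
lowers the degree, so by descent \<open>\<xi>\<close> is linear.  The images of the symmetric elements \<open>x + y\<close> and
\<open>[[x,y],x-y]\<close> determine the shape of its matrix.\<close>

section \<open>Multiplication of noncommutative series\<close>

lemma ncmul_Nil [simp]: "ncmul p q [] = p [] * q []"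
  by (simp add: ncmul_def)

text \<open>The cut before \<open>a\<close> is split off; every other cut puts \<open>a\<close> into
  the left factor, which becomes the left derivative of \<open>p\<close> by \<open>a\<close>. This
  recursion, with \<open>p\<close> kept arbitrary, drives the inductions over words below.\<close>

lemma ncmul_Cons: "ncmul p q (a # w) = p [] * q (a # w) + ncmul (\<lambda>w. p (a # w)) q w"
  by (simp add: ncmul_def sum.atMost_Suc_shift del: sum.atMost_Suc)

lemma ncmul_add_left: "ncmul (\<lambda>w. p w + q w) r = (\<lambda>w. ncmul p r w + ncmul q r w)"
  by (simp add: ncmul_def fun_eq_iff distrib_right sum.distrib)

lemma ncmul_add_right: "ncmul p (\<lambda>w. q w + r w) = (\<lambda>w. ncmul p q w + ncmul p r w)"
  by (simp add: ncmul_def fun_eq_iff distrib_left sum.distrib)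

lemma ncmul_diff_left: "ncmul (\<lambda>w. p w - q w) r = (\<lambda>w. ncmul p r w - ncmul q r w)"
  by (simp add: ncmul_def fun_eq_iff left_diff_distrib sum_subtractf)

lemma ncmul_diff_right: "ncmul p (\<lambda>w. q w - r w) = (\<lambda>w. ncmul p q w - ncmul p r w)"
  by (simp add: ncmul_def fun_eq_iff right_diff_distrib sum_subtractf)

lemma ncmul_scale_left: "ncmul (\<lambda>w. c * p w) q = (\<lambda>w. c * ncmul p q w)"
  by (simp add: ncmul_def fun_eq_iff sum_distrib_left mult.assoc)

lemma ncmul_scale_right: "ncmul p (\<lambda>w. c * q w) = (\<lambda>w. c * ncmul p q w)"
  by (simp add: ncmul_def fun_eq_iff sum_distrib_left mult.left_commute)

lemma ncmul_zero [simp]: "ncmul (\<lambda>w. 0) q = (\<lambda>w. 0)" "ncmul p (\<lambda>w. 0) = (\<lambda>w. 0)"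
  by (simp_all add: ncmul_def)

lemmas ncmul_linear = ncmul_add_left ncmul_add_right ncmul_diff_left ncmul_diff_right
  ncmul_scale_left ncmul_scale_right

lemma ncmul_assoc: "ncmul (ncmul p q) r = ncmul p (ncmul q r)"
proof
  fix w show "ncmul (ncmul p q) r w = ncmul p (ncmul q r) w"
    by (induction w arbitrary: p) (simp_all add: ncmul_Cons ncmul_linear algebra_simps)
qed

lemma ncmul_letter: "ncmul (\<lambda>w. if w = [l] then 1 else 0) h w =
    (case w of [] \<Rightarrow> 0 | a # v \<Rightarrow> if a = l then h v else 0)"
proof (cases w)
  case (Cons a v)
  have "ncmul (\<lambda>w. if w = [] then 1 else 0) h v = h v"
    by (cases v) (simp_all add: ncmul_Cons)
  then show ?thesis using Cons by (simp add: ncmul_Cons)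
qed simp

definition ncone :: "'a::field ncp" where
  "ncone = (\<lambda>w. if w = [] then 1 else 0)"

lemma ncmul_one [simp]: "ncmul p ncone = p"
proof
  fix w show "ncmul p ncone w = p w"
    by (induction w arbitrary: p) (simp_all add: ncmul_Cons ncone_def)
qed

section \<open>Homogeneous components\<close>

definition homog :: "nat \<Rightarrow> 'a::field ncp \<Rightarrow> bool" where
  "homog n p \<longleftrightarrow> (\<forall>w. length w \<noteq> n \<longrightarrow> p w = 0)"

definition hcomp :: "nat \<Rightarrow> 'a::field ncp \<Rightarrow> 'a ncp" where
  "hcomp n p = (\<lambda>w. if length w = n then p w else 0)"

definition bounded_deg :: "nat \<Rightarrow> 'a::field ncp \<Rightarrow> bool" where
  "bounded_deg n p \<longleftrightarrow> (\<forall>w. n < length w \<longrightarrow> p w = 0)"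

lemma homog_hcomp: "homog n (hcomp n p)"
  by (simp add: homog_def hcomp_def)

text \<open>Only the cut after \<open>e\<close> letters can contribute, so the sum collapses to one
  term. This makes left division by a homogeneous factor explicit.\<close>

lemma ncmul_homog_left:
  assumes "homog e g"
  shows "ncmul g p u = (if length u < e then 0 else g (take e u) * p (drop e u))"
proof (cases "length u < e")
  case False
  have "ncmul g p u = (\<Sum>i\<in>{e}. g (take i u) * p (drop i u))"
    unfolding ncmul_def
    by (rule sum.mono_neutral_right) (use False assms in \<open>auto simp: homog_def\<close>)
  then show ?thesis using False by simp
next
  case True
  then show ?thesis using assms
    by (auto simp: homog_def ncmul_def intro!: sum.neutral)
qed

lemma homog_ncmul:
  assumes "homog e g" "homog m h"
  shows "homog (e + m) (ncmul g h)"
  using assms by (auto simp: ncmul_homog_left homog_def)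

text \<open>In a word of length \<open>d + n\<close>, any cut other than the one at \<open>d\<close>
  makes one of the two pieces too long. Hence top coefficients multiply without
  cancellation.\<close>

lemma ncmul_top:
  assumes "bounded_deg d p" "bounded_deg n q"
  shows "bounded_deg (d + n) (ncmul p q)"
    and "length w = d + n \<Longrightarrow> ncmul p q w = p (take d w) * q (drop d w)"
proof -
  have z: "p (take i w) * q (drop i w) = 0"
    if "d + n \<le> length w" "i \<le> length w" "length w = d + n \<longrightarrow> i \<noteq> d" for i w
  proof -
    have "d < length (take i w) \<or> n < length (drop i w)" using that by auto
    then show ?thesis using assms unfolding bounded_deg_def by fastforce
  qed
  show "bounded_deg (d + n) (ncmul p q)"
    unfolding bounded_deg_def ncmul_def by (auto intro!: sum.neutral z)
  assume w: "length w = d + n"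
  have "ncmul p q w = (\<Sum>i\<in>{d}. p (take i w) * q (drop i w))"
    unfolding ncmul_def by (rule sum.mono_neutral_right) (use w z[of w] in auto)
  then show "ncmul p q w = p (take d w) * q (drop d w)" by simp
qed

lemma bounded_deg_add: "bounded_deg m p \<Longrightarrow> bounded_deg n q \<Longrightarrow> bounded_deg (max m n) (\<lambda>w. p w + q w)"
  by (simp add: bounded_deg_def)

lemma bounded_deg_diff: "bounded_deg m p \<Longrightarrow> bounded_deg n q \<Longrightarrow> bounded_deg (max m n) (\<lambda>w. p w - q w)"
  by (simp add: bounded_deg_def)

lemma bounded_deg_scale: "bounded_deg n p \<Longrightarrow> bounded_deg n (\<lambda>w. c * p w)"
  by (simp add: bounded_deg_def)

lemma exact_degree:
  assumes "bounded_deg n p" "p \<noteq> (\<lambda>w. 0)"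
  obtains d w where "bounded_deg d p" "length w = d" "p w \<noteq> 0" "d \<le> n"
proof -
  define d where "d = (LEAST n. bounded_deg n p)"
  have d: "bounded_deg d p" unfolding d_def using assms(1) by (rule LeastI)
  have dn: "d \<le> n" unfolding d_def using assms(1) by (rule Least_le)
  have "\<exists>w. length w = d \<and> p w \<noteq> 0"
  proof (rule ccontr)
    assume n: "\<not> ?thesis"
    show False
    proof (cases d)
      case 0
      obtain w where "p w \<noteq> 0" using assms(2) by auto
      then show False using d n 0 by (cases "w = []") (auto simp: bounded_deg_def)
    next
      case (Suc k)
      have "bounded_deg k p"
        unfolding bounded_deg_def
      proof (intro allI impI)
        fix w :: "bool list" assume "k < length w"
        then have "length w = d \<or> d < length w" using Suc by auto
        then show "p w = 0" using n d by (auto simp: bounded_deg_def)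
      qed
      then have "d \<le> k" unfolding d_def by (rule Least_le)
      then show False using Suc by simp
    qed
  qed
  then show thesis using that d dn by blast
qed

section \<open>Lie elements\<close>

lemma L2_zero: "(\<lambda>w. 0) \<in> (L2 :: 'a::field ncp set)"
  using L2.smul[OF L2.gen_x, of 0] by (simp add: ncsmul_def)

lemma L2_add: "p \<in> L2 \<Longrightarrow> q \<in> L2 \<Longrightarrow> (\<lambda>w. p w + q w) \<in> L2"
  using L2.add[of p q] by (simp add: ncadd_def)

lemma L2_scale: "p \<in> L2 \<Longrightarrow> (\<lambda>w. c * p w) \<in> L2"
  using L2.smul[of p c] by (simp add: ncsmul_def)

lemma L2_sum: "finite I \<Longrightarrow> (\<And>i. i \<in> I \<Longrightarrow> p i \<in> L2) \<Longrightarrow> (\<lambda>w. \<Sum>i\<in>I. p i w) \<in> L2"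
  by (induction I rule: finite_induct) (auto intro: L2_zero L2_add)

lemma L2_Nil: "p \<in> L2 \<Longrightarrow> p [] = 0"
  by (induction rule: L2.induct) (auto simp: ncX_def ncY_def ncadd_def ncsmul_def ncbr_def)

lemma L2_bounded_deg: "p \<in> L2 \<Longrightarrow> \<exists>n. bounded_deg n p"
proof (induction rule: L2.induct)
  case (br p q)
  then obtain m n where "bounded_deg m p" "bounded_deg n q" by blast
  then show ?case
    unfolding ncbr_def using bounded_deg_diff[OF ncmul_top(1) ncmul_top(1)] by blast
next
  case (add p q)
  then show ?case unfolding ncadd_def using bounded_deg_add by blast
next
  case (smul p c)
  then show ?case unfolding ncsmul_def using bounded_deg_scale by blast
qed (auto simp: ncX_def ncY_def bounded_deg_def intro!: exI[of _ 1])

lemma hcomp_ncbr: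
  "hcomp n (ncbr p q) = (\<lambda>w. \<Sum>i\<le>n. ncbr (hcomp i p) (hcomp (n - i) q) w)"
proof
  fix w :: "bool list"
  show "hcomp n (ncbr p q) w = (\<Sum>i\<le>n. ncbr (hcomp i p) (hcomp (n - i) q) w)"
  proof (cases "length w = n")
    case True
    \<comment> \<open>The negative part of the bracket has its factors in reverse order, so its
      index is reflected to \<open>n - i\<close>.\<close>
    have "(\<Sum>i\<le>n. ncmul (hcomp (n - i) q) (hcomp i p) w) = (\<Sum>i\<le>n. ncmul (hcomp i q) (hcomp (n - i) p) w)"
      by (rule sum.reindex_bij_witness[of _ "\<lambda>i. n - i" "\<lambda>i. n - i"]) auto
    then show ?thesis using True
      by (simp add: ncbr_def sum_subtractf ncmul_homog_left[OF homog_hcomp])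
        (simp add: hcomp_def ncmul_def)
  next
    case False
    then have "ncbr (hcomp i p) (hcomp (n - i) q) w = 0" if "i \<le> n" for i
      using that by (simp add: ncbr_def ncmul_homog_left[OF homog_hcomp]) (auto simp: hcomp_def)
    then show ?thesis using False by (simp add: hcomp_def)
  qed
qed

text \<open>The generators are homogeneous and the bracket respects degrees, so \<open>L2\<close> is
  graded. The use below is that leading forms of Lie elements are again Lie elements.\<close>

lemma hcomp_L2: "p \<in> L2 \<Longrightarrow> hcomp n p \<in> L2"
proof (induction arbitrary: n rule: L2.induct)
  case gen_x
  have "hcomp n ncX = (if n = 1 then ncX else (\<lambda>w. 0 :: 'a))"
    by (auto simp: hcomp_def ncX_def fun_eq_iff)
  then show ?case using L2.gen_x L2_zero by metis
next
  case gen_y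
  have "hcomp n ncY = (if n = 1 then ncY else (\<lambda>w. 0 :: 'a))"
    by (auto simp: hcomp_def ncY_def fun_eq_iff)
  then show ?case using L2.gen_y L2_zero by metis
next
  case (add p q)
  have "hcomp n (ncadd p q) = ncadd (hcomp n p) (hcomp n q)"
    by (auto simp: hcomp_def ncadd_def)
  then show ?case using add L2.add by metis
next
  case (smul p c)
  have "hcomp n (ncsmul c p) = ncsmul c (hcomp n p)"
    by (auto simp: hcomp_def ncsmul_def)
  then show ?case using smul L2.smul by metis
next
  case (br p q)
  then show ?case unfolding hcomp_ncbr by (intro L2_sum L2.br) auto
qed

section \<open>The shuffle coproduct\<close>

text \<open>\<open>coprod p u v\<close> is the coefficient of \<open>u \<otimes> v\<close> in the coproduct of \<open>p\<close> for which the letters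
are primitive, that is, the sum of \<open>p\<close> over all shuffles of \<open>u\<close> and \<open>v\<close>.\<close>

fun coprod :: "'a::field ncp \<Rightarrow> bool list \<Rightarrow> bool list \<Rightarrow> 'a" where
  "coprod p [] v = p v"
| "coprod p (a # u) [] = p (a # u)"
| "coprod p (a # u) (b # v) =
     coprod (\<lambda>w. p (a # w)) u (b # v) + coprod (\<lambda>w. p (b # w)) (a # u) v"

lemma coprod_Nil [simp]: "coprod p [] = p" "coprod p u [] = p u"
  by (auto, cases u) auto

lemma coprod_add: "coprod (\<lambda>w. p w + q w) u v = coprod p u v + coprod q u v"
proof (induction p u v arbitrary: q rule: coprod.induct)
  case (3 p a u b v)
  show ?case using "3.IH"(1)[of "\<lambda>w. q (a # w)"] "3.IH"(2)[of "\<lambda>w. q (b # w)"] by simp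
qed auto

lemma coprod_scale: "coprod (\<lambda>w. c * p w) u v = c * coprod p u v"
  by (induction p u v rule: coprod.induct) (auto simp: distrib_left)

lemma coprod_diff: "coprod (\<lambda>w. p w - q w) u v = coprod p u v - coprod q u v"
  using coprod_add[of p "\<lambda>w. - 1 * q w" u v] coprod_scale[of "- 1" q u v] by simp

lemma coprod_eq_0:
  "(\<And>w. length w = length u + length v \<Longrightarrow> p w = 0) \<Longrightarrow> coprod p u v = 0"
  by (induction p u v rule: coprod.induct) auto

lemma homog_coprod:
  assumes "homog m h" "length u \<le> m"
  shows "homog (m - length u) (coprod h u)"
  using assms unfolding homog_def by (auto intro!: coprod_eq_0)

text \<open>The first letter of a shuffle comes either from \<open>u\<close> or from
  \<open>v\<close>. In coproduct terms, \<Delta>(l h) = (l \<otimes> 1 + 1 \<otimes> l) \<Delta>(h)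
  for a letter l.\<close>

lemma coprod_letter_mult:
  fixes h :: "'a::field ncp"
  defines "x \<equiv> \<lambda>l w. if w = [l] then 1 else 0"
  shows "coprod (ncmul (x l) h) u v =
    ncmul (x l) (\<lambda>u. coprod h u v) u + ncmul (x l) (coprod h u) v"
proof -
  have 1: "(\<lambda>w. ncmul (x l) h (a # w)) = (if a = l then h else (\<lambda>w. 0))" for a
    unfolding x_def by (auto simp: ncmul_letter)
  have 2: "coprod (\<lambda>w. 0 :: 'a) u v = 0" for u v
    by (simp add: coprod_eq_0)
  show ?thesis
  proof (cases u)
    case Nil
    then show ?thesis by (simp add: x_def)
  next
    case u: (Cons a u')
    show ?thesis
    proof (cases v)
      case Nil
      then show ?thesis by (simp add: x_def)
    next
      case (Cons b v')
      then show ?thesis using u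
        by (simp add: 1 2 x_def[symmetric]) (simp add: x_def ncmul_letter 2)
    qed
  qed
qed

text \<open>The operators g \<otimes> 1 + 1 \<otimes> g are closed under commutators, because the
  mixed terms cancel. Treating only left multiplication by a Lie element avoids proving that the
  whole coproduct is multiplicative.\<close>

lemma coprod_Lie_mult:
  "g \<in> L2 \<Longrightarrow> coprod (ncmul g h) u v = ncmul g (\<lambda>u. coprod h u v) u + ncmul g (coprod h u) v"
proof (induction arbitrary: h u v rule: L2.induct)
  case gen_x
  then show ?case unfolding ncX_def by (rule coprod_letter_mult)
next
  case gen_y
  then show ?case unfolding ncY_def by (rule coprod_letter_mult)
next
  case (add p q)
  then show ?case by (simp add: ncadd_def ncmul_linear coprod_add)
next
  case (smul p c)
  then show ?case by (simp add: ncsmul_def ncmul_linear coprod_scale distrib_left)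
next
  case (br p q)
  \<comment> \<open>Multiplications in different tensor factors commute; this is what cancels the
    mixed terms.\<close>
  have swap: "ncmul p (\<lambda>u. ncmul q (M u) v) u = ncmul q (\<lambda>v. ncmul p (\<lambda>u. M u v) u) v"
    for p q :: "'a ncp" and M u v
    unfolding ncmul_def by (simp add: sum_distrib_left mult.left_commute, rule sum.swap)
  have "coprod (ncmul p (ncmul q h)) u v =
      ncmul (ncmul p q) (\<lambda>u. coprod h u v) u + ncmul p (\<lambda>u. ncmul q (coprod h u) v) u +
      (ncmul q (\<lambda>u. ncmul p (coprod h u) v) u + ncmul (ncmul p q) (coprod h u) v)"
    by (simp add: br.IH ncmul_linear ncmul_assoc swap[of q p])
  moreover have "coprod (ncmul q (ncmul p h)) u v =
      ncmul (ncmul q p) (\<lambda>u. coprod h u v) u + ncmul q (\<lambda>u. ncmul p (coprod h u) v) u +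
      (ncmul p (\<lambda>u. ncmul q (coprod h u) v) u + ncmul (ncmul q p) (coprod h u) v)"
    by (simp add: br.IH ncmul_linear ncmul_assoc swap[of p q])
  ultimately show ?case
    by (simp add: ncbr_def ncmul_linear coprod_diff ncmul_assoc)
qed

text \<open>The easy half of Friedrichs' criterion: multiply \<open>ncone\<close> by
  \<open>g\<close> and use that the coproduct of 1 is 1 \<otimes> 1.\<close>

lemma coprod_Lie_primitive:
  assumes "g \<in> L2" "u \<noteq> []" "v \<noteq> []"
  shows "coprod g u v = 0"
proof -
  have *: "coprod ncone u v = (if u = [] \<and> v = [] then 1 else 0 :: 'a)" for u v
    by (cases u; cases v) (auto simp: ncone_def coprod_eq_0)
  have "(\<lambda>u. coprod ncone u v) = (\<lambda>u. 0 :: 'a)" "coprod ncone u = (\<lambda>v. 0 :: 'a)"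
    using assms by (simp_all add: * fun_eq_iff)
  then show ?thesis using coprod_Lie_mult[OF assms(1), of ncone u v] by simp
qed

section \<open>Divisibility among Lie elements\<close>

lemma homog_ncmul_eq_0:
  assumes "homog e g" "length z = e" "g z \<noteq> 0" "ncmul g p = (\<lambda>w. 0)"
  shows "p = (\<lambda>w. 0)"
proof
  fix v show "p v = 0"
    using fun_cong[OF assms(4), of "z @ v"] assms(1-3) by (simp add: ncmul_homog_left)
qed

text \<open>The part of \<Delta>(g^(j+1) h) with first tensor factor \<open>z\<close> is g^j ((j+1)
  g(z) h + g h_z), where h_z is \<open>coprod h z\<close>. If it vanishes, cancelling g^j and
  dividing by (j+1) g(z), possible in characteristic zero, gives h = g h' with h' of degree m - e.
  Then g^(j+1) h = g^(j+2) h' and the descent continues.\<close>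

lemma Lie_power_mult_not_primitive:
  fixes g :: "'a::field_char_0 ncp"
  assumes g: "g \<in> L2" "homog e g" "length z = e" "g z \<noteq> 0" "e > 0"
  shows "homog m h \<Longrightarrow> Suc j * e + m > e \<Longrightarrow>
    (\<And>v. v \<noteq> [] \<Longrightarrow> coprod ((ncmul g ^^ Suc j) h) z v = 0) \<Longrightarrow> h = (\<lambda>w. 0)"
proof (induction m arbitrary: j h rule: less_induct)
  case (less m)
  have coprod_z: "coprod (ncmul g k) z = (\<lambda>v. g z * k v + ncmul g (coprod k z) v)" for k
    using g by (auto simp: coprod_Lie_mult ncmul_homog_left)
  have cancel: "k = (\<lambda>w. 0)" if "(ncmul g ^^ i) k = (\<lambda>w. 0)" for i k
    using that
  proof (induction i)
    case (Suc i)
    then show ?case using homog_ncmul_eq_0[OF g(2-4)] by simp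
  qed simp
  let ?r = "\<lambda>j v. of_nat (Suc j) * g z * h v + ncmul g (coprod h z) v"
  have power: "coprod ((ncmul g ^^ Suc j) h) z = (ncmul g ^^ j) (?r j)" for j
  proof (induction j)
    case 0
    show ?case by (simp add: coprod_z)
  next
    case (Suc j)
    have lin: "(ncmul g ^^ i) (\<lambda>v. c * k v + l v) = (\<lambda>v. c * (ncmul g ^^ i) k v + (ncmul g ^^ i) l v)"
      for i c k l
      by (induction i) (simp_all add: ncmul_linear)
    have eq: "?r (Suc j) = (\<lambda>v. g z * h v + ?r j v)"
      by (simp add: fun_eq_iff algebra_simps)
    have "coprod ((ncmul g ^^ Suc (Suc j)) h) z =
        (\<lambda>v. g z * (ncmul g ^^ Suc j) h v + ncmul g (coprod ((ncmul g ^^ Suc j) h) z) v)"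
      by (simp add: coprod_z)
    also have "\<dots> = (\<lambda>v. g z * (ncmul g ^^ Suc j) h v + (ncmul g ^^ Suc j) (?r j) v)"
      unfolding Suc by (simp only: funpow.simps(2) o_def)
    also have "\<dots> = (ncmul g ^^ Suc j) (?r (Suc j))"
      unfolding eq lin ..
    finally show ?case .
  qed
  have hom: "homog (i * e + m) ((ncmul g ^^ i) h)" for i
    by (induction i) (use less.prems(1) homog_ncmul[OF g(2)] in \<open>auto simp: add.assoc\<close>)
  \<comment> \<open>For \<open>v = []\<close> this is the value at \<open>z\<close>, which vanishes
    because the total degree \<open>Suc j * e + m\<close> exceeds \<open>e\<close>.\<close>
  have "coprod ((ncmul g ^^ Suc j) h) z v = 0" for v
  proof (cases "v = []")
    case True
    then show ?thesis using hom[of "Suc j"] less.prems(2) g(3)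
      by (simp add: homog_def del: funpow.simps)
  qed (rule less.prems(3))
  then have "(ncmul g ^^ j) (?r j) = (\<lambda>v. 0)"
    unfolding power by (rule ext)
  then have "?r j = (\<lambda>v. 0)" by (rule cancel)
  then have r: "of_nat (Suc j) * g z * h v + ncmul g (coprod h z) v = 0" for v
    by (rule fun_cong)
  define c where "c = - (1 / (of_nat (Suc j) * g z))"
  have nz: "of_nat (Suc j) * g z \<noteq> 0" using g(4) of_nat_neq_0 by (metis mult_eq_0_iff)
  have solve: "x = - (1 / k) * y" if "k * x + y = 0" "k \<noteq> 0" for k x y :: 'a
    using that by (simp add: field_simps eq_neg_iff_add_eq_0)
  have "h v = ncmul g (\<lambda>w. c * coprod h z w) v" for v
    unfolding ncmul_linear c_def by (rule solve[OF r nz])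
  then have h: "h = ncmul g (\<lambda>w. c * coprod h z w)" by blast
  show ?case
  proof (cases "e \<le> m")
    case True
    have "(\<lambda>w. c * coprod h z w) = (\<lambda>w. 0)"
    proof (rule less.IH)
      show "m - e < m" using True g(5) by simp
      show "homog (m - e) (\<lambda>w. c * coprod h z w)"
        using homog_coprod[OF less.prems(1), of z] True g(3) by (simp add: homog_def)
      show "e < Suc (Suc j) * e + (m - e)" using g(5) by simp
      show "coprod ((ncmul g ^^ Suc (Suc j)) (\<lambda>w. c * coprod h z w)) z v = 0" if "v \<noteq> []" for v
        using less.prems(3)[OF that] h by (simp only: funpow_Suc_right o_def)
    qed
    then show ?thesis using h by simp
  next
    case False
    \<comment> \<open>The descent ends here: \<open>z\<close> is longer than every word in the
      support of \<open>h\<close>.\<close>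
    then have "coprod h z = (\<lambda>w. 0)"
      using less.prems(1) g(3) by (auto simp: homog_def intro!: coprod_eq_0)
    then show ?thesis using h by simp
  qed
qed

text \<open>Stripping the fixed suffix \<open>s\<close> from the relation exhibits \<open>f\<close>
  as a right multiple g h. Since \<open>f\<close> is primitive, \<open>h\<close> cannot have
  positive degree, so it is a scalar.\<close>

lemma leading_forms_proportional:
  fixes f g :: "'a::field_char_0 ncp"
  assumes f: "f \<in> L2" "homog d f" and g: "g \<in> L2" "homog e g" "g \<noteq> (\<lambda>w. 0)"
    and de: "e \<le> d" and rel: "\<And>w. length w = d + length s \<Longrightarrow> ncmul f a w + ncmul g b w = 0"
    and s: "a s \<noteq> 0" and nz: "f \<noteq> (\<lambda>w. 0)"
  obtains c where "d = e" "f = (\<lambda>w. c * g w)"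
proof -
  obtain z where z: "g z \<noteq> 0" using g(3) by auto
  then have lz: "length z = e" using g(2) by (auto simp: homog_def)
  have e: "e > 0" using z lz L2_Nil[OF g(1)] by (cases z) auto
  \<comment> \<open>The relation at \<open>u @ s\<close> reads f(u) a(s) = - g(u') b(u'' @ s), where
    u' consists of the first \<open>e\<close> letters of u and u'' of the rest; dividing by
    \<open>a s\<close> gives this \<open>h\<close>.\<close>
  define h where "h = hcomp (d - e) (\<lambda>w. - b (w @ s) / a s)"
  have fgh: "f = ncmul g h"
  proof
    fix u show "f u = ncmul g h u"
    proof (cases "length u = d")
      case True
      have "f u * a s + g (take e u) * b (drop e u @ s) = 0"
        using rel[of "u @ s"] True f(2) g(2) de by (simp add: ncmul_homog_left)
      then have "f u * a s = - (g (take e u) * b (drop e u @ s))"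
        by (simp add: eq_neg_iff_add_eq_0)
      then have "f u = - (g (take e u) * b (drop e u @ s)) / a s"
        using s by (metis nonzero_eq_divide_eq)
      then show ?thesis
        using True de g(2) by (simp add: ncmul_homog_left h_def hcomp_def)
    next
      case False
      then show ?thesis
        using f(2) g(2) de by (auto simp: ncmul_homog_left h_def hcomp_def homog_def)
    qed
  qed
  have "d = e"
  proof (rule ccontr)
    assume "d \<noteq> e"
    have "h = (\<lambda>w. 0)"
    proof (rule Lie_power_mult_not_primitive[OF g(1,2) lz z e, where m = "d - e" and j = 0])
      show "homog (d - e) h" by (simp add: h_def homog_hcomp)
      show "e < Suc 0 * e + (d - e)" using \<open>d \<noteq> e\<close> de by simp
      show "coprod ((ncmul g ^^ Suc 0) h) z v = 0" if "v \<noteq> []" for v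
        using coprod_Lie_primitive[OF f(1) _ that, of z] lz e fgh by auto
    qed
    then show False using nz fgh by simp
  qed
  moreover have "f u = h [] * g u" for u
    using \<open>d = e\<close> f(2) g(2) by (auto simp: fgh ncmul_homog_left homog_def h_def hcomp_def)
  ultimately show thesis using that by blast
qed

section \<open>Generating pairs are linear\<close>

text \<open>The type \<open>ncp\<close> contains all formal series. The degree bounds restrict the
  coefficients to polynomials, so that they have a top degree.\<close>

definition right_ideal2 :: "'a::field ncp \<Rightarrow> 'a ncp \<Rightarrow> 'a ncp set" where
  "right_ideal2 f g = {p. \<exists>a b m n. bounded_deg m a \<and> bounded_deg n b \<and>
     p = (\<lambda>w. ncmul f a w + ncmul g b w)}"

lemma right_ideal2_commute: "right_ideal2 f g = right_ideal2 g f"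
  unfolding right_ideal2_def by (auto simp: add.commute)

lemma right_ideal2_left: "f \<in> right_ideal2 f g"
proof -
  have "bounded_deg 0 ncone" "bounded_deg 0 (\<lambda>w. 0)"
    by (simp_all add: bounded_deg_def ncone_def)
  moreover have "f = (\<lambda>w. ncmul f ncone w + ncmul g (\<lambda>w. 0) w)" by simp
  ultimately show ?thesis unfolding right_ideal2_def by blast
qed

lemma right_ideal2_add:
  assumes "p \<in> right_ideal2 f g" "q \<in> right_ideal2 f g"
  shows "(\<lambda>w. p w + q w) \<in> right_ideal2 f g"
proof -
  from assms obtain a b m n a' b' m' n'
    where b: "bounded_deg m a" "bounded_deg n b" "bounded_deg m' a'" "bounded_deg n' b'"
      and eq: "p = (\<lambda>w. ncmul f a w + ncmul g b w)" "q = (\<lambda>w. ncmul f a' w + ncmul g b' w)"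
    unfolding right_ideal2_def by blast
  have "(\<lambda>w. p w + q w) =
      (\<lambda>w. ncmul f (\<lambda>w. a w + a' w) w + ncmul g (\<lambda>w. b w + b' w) w)"
    by (simp add: eq ncmul_linear algebra_simps)
  then show ?thesis using b bounded_deg_add unfolding right_ideal2_def by blast
qed

lemma right_ideal2_mult:
  assumes "p \<in> right_ideal2 f g" "bounded_deg k r"
  shows "ncmul p r \<in> right_ideal2 f g"
proof -
  from assms obtain a b m n where b: "bounded_deg m a" "bounded_deg n b"
      and eq: "p = (\<lambda>w. ncmul f a w + ncmul g b w)"
    unfolding right_ideal2_def by blast
  have "ncmul p r = (\<lambda>w. ncmul f (ncmul a r) w + ncmul g (ncmul b r) w)"
    by (simp add: eq ncmul_linear ncmul_assoc)
  then show ?thesis using b assms(2) ncmul_top(1) unfolding right_ideal2_def by blast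
qed

lemma right_ideal2_scale:
  assumes "p \<in> right_ideal2 f g"
  shows "(\<lambda>w. c * p w) \<in> right_ideal2 f g"
proof -
  have "bounded_deg 0 (\<lambda>w. c * ncone w)" by (simp add: bounded_deg_def ncone_def)
  from right_ideal2_mult[OF assms this] show ?thesis by (simp add: ncmul_linear)
qed

text \<open>From fa + gb = (f - cg)a + g(b + ca): membership of the letters survives a
  degree-lowering step.\<close>

lemma right_ideal2_shear:
  "right_ideal2 f g \<subseteq> right_ideal2 (\<lambda>w. f w - c * g w) g"
proof
  fix p assume "p \<in> right_ideal2 f g"
  then obtain a b m n where b: "bounded_deg m a" "bounded_deg n b"
      and eq: "p = (\<lambda>w. ncmul f a w + ncmul g b w)"
    unfolding right_ideal2_def by blast
  have "p = (\<lambda>w. ncmul (\<lambda>w. f w - c * g w) a w + ncmul g (\<lambda>w. b w + c * a w) w)"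
    by (simp add: eq ncmul_linear)
  then show "p \<in> right_ideal2 (\<lambda>w. f w - c * g w) g"
    using b bounded_deg_add[OF b(2) bounded_deg_scale[OF b(1)]]
    unfolding right_ideal2_def by blast
qed

text \<open>As \<open>g\<close> has no constant term, the linear part of gb is a scalar multiple of
  that of \<open>g\<close>, and x and y are not both multiples of one linear form.\<close>

lemma letters_not_in_principal_right_ideal:
  assumes "g [] = 0" "ncX = ncmul g b" "ncY = ncmul g b'"
  shows False
proof -
  have "g [True] * b [] = 1" "g [False] * b [] = 0" "g [False] * b' [] = 1"
    using fun_cong[OF assms(2), of "[True]"] fun_cong[OF assms(2), of "[False]"]
      fun_cong[OF assms(3), of "[False]"] assms(1)
    by (simp_all add: ncX_def ncY_def ncmul_Cons)
  then show False by auto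
qed

text \<open>The degree bound on \<open>p\<close> forces the top degree parts of \<open>fa\<close> and \<open>gb\<close> to cancel unless
\<open>a = 0\<close>.\<close>

lemma leading_form_or_trivial_coefficient:
  fixes f g :: "'a::field_char_0 ncp"
  assumes f: "f \<in> L2" "bounded_deg d f" "length zf = d" "f zf \<noteq> 0"
    and g: "g \<in> L2" "bounded_deg e g" "length zg = e" "g zg \<noteq> 0"
    and de: "e \<le> d" "2 \<le> d"
    and ab: "bounded_deg m a" "bounded_deg n b"
    and p: "p = (\<lambda>w. ncmul f a w + ncmul g b w)" "bounded_deg 1 p"
  shows "a = (\<lambda>w. 0) \<or> (d = e \<and> (\<exists>c. hcomp d f = (\<lambda>w. c * hcomp d g w)))"
proof (cases "a = (\<lambda>w. 0)")
  case False
  then obtain k s where a: "bounded_deg k a" "length s = k" "a s \<noteq> 0"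
    using exact_degree[OF ab(1)] by metis
  have p0: "ncmul f a w + ncmul g b w = 0" if "length w > 1" for w
    using p that by (simp add: bounded_deg_def)
  have fa: "ncmul f a (zf @ s) \<noteq> 0"
    using ncmul_top(2)[OF f(2) a(1), of "zf @ s"] f a by simp
  \<comment> \<open>The word \<open>zf @ s\<close> has length at least 2, where p vanishes, so gb
    must cancel the nonzero top coefficient of fa. With the mirror argument at \<open>zg @ t\<close>
    this forces equal degrees of the two products.\<close>
  have gb: "ncmul g b (zf @ s) \<noteq> 0"
    using p0[of "zf @ s"] fa f(3) de by auto
  then have "b \<noteq> (\<lambda>w. 0)" by auto
  then obtain l t where b: "bounded_deg l b" "length t = l" "b t \<noteq> 0"
    using exact_degree[OF ab(2)] by metis
  have "d + k \<le> e + l"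
    using gb ncmul_top(1)[OF g(2) b(1)] f(3) a(2) by (force simp: bounded_deg_def)
  moreover have "e + l \<le> d + k"
  proof (rule ccontr)
    assume *: "\<not> e + l \<le> d + k"
    then have "ncmul f a (zg @ t) = 0"
      using ncmul_top(1)[OF f(2) a(1)] g(3) b(2) by (auto simp: bounded_deg_def)
    moreover have "ncmul g b (zg @ t) \<noteq> 0"
      using ncmul_top(2)[OF g(2) b(1), of "zg @ t"] g b by simp
    ultimately show False using p0[of "zg @ t"] * de g(3) b(2) by auto
  qed
  ultimately have el: "e + l = d + k" by simp
  \<comment> \<open>In the common top degree the products see only the leading forms of
    \<open>f\<close> and \<open>g\<close>.\<close>
  have rel: "ncmul (hcomp d f) a w + ncmul (hcomp e g) b w = 0" if "length w = d + length s" for w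
  proof -
    have "ncmul (hcomp d f) a w = ncmul f a w"
      using that a(2) ncmul_top(2)[OF f(2) a(1), of w]
      by (simp add: ncmul_homog_left[OF homog_hcomp]) (simp add: hcomp_def)
    moreover have "ncmul (hcomp e g) b w = ncmul g b w"
      using that a(2) el ncmul_top(2)[OF g(2) b(1), of w]
      by (simp add: ncmul_homog_left[OF homog_hcomp]) (simp add: hcomp_def)
    ultimately show ?thesis using p0[of w] that de by simp
  qed
  have "hcomp d f zf \<noteq> 0" "hcomp e g zg \<noteq> 0" using f g by (simp_all add: hcomp_def)
  then have "hcomp d f \<noteq> (\<lambda>w. 0)" "hcomp e g \<noteq> (\<lambda>w. 0)" by auto
  then show ?thesis
    using leading_forms_proportional[OF hcomp_L2[OF f(1)] homog_hcomp hcomp_L2[OF g(1)] homog_hcomp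
        _ de(1) rel a(3)] by metis
qed simp

text \<open>Descent on the sum of the degree bounds: as long as the larger degree is at least 2, the
  leading forms are proportional and subtracting a multiple of one element from the other lowers its
  degree.\<close>

lemma generating_pair_linear:
  fixes f g :: "'a::field_char_0 ncp"
  assumes "f \<in> L2" "g \<in> L2" "bounded_deg m f" "bounded_deg n g"
    "ncX \<in> right_ideal2 f g" "ncY \<in> right_ideal2 f g"
  shows "bounded_deg 1 f \<and> bounded_deg 1 g"
  using assms
proof (induction "m + n" arbitrary: m n f g rule: less_induct)
  case less
  have nz: "g \<noteq> (\<lambda>w. 0)" if "f \<in> L2" "ncX \<in> right_ideal2 f g" "ncY \<in> right_ideal2 f g"
    for f g :: "'a ncp"
  proof
    assume "g = (\<lambda>w. 0)"
    with that(2,3) obtain a a' where "ncX = ncmul f a" "ncY = ncmul f a'"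
      by (auto simp: right_ideal2_def)
    then show False using letters_not_in_principal_right_ideal L2_Nil that(1) by blast
  qed
  have step: "bounded_deg 1 f \<and> bounded_deg 1 g"
    if f: "f \<in> L2" "bounded_deg d f" "length zf = d" "f zf \<noteq> 0"
      and g: "g \<in> L2" "bounded_deg e g" "length zg = e" "g zg \<noteq> 0"
      and le: "d + e \<le> m + n" "e \<le> d"
      and xy: "ncX \<in> right_ideal2 f g" "ncY \<in> right_ideal2 f g"
    for f g :: "'a ncp" and d e zf zg
  proof (cases "2 \<le> d")
    case d: True
    have b1: "bounded_deg 1 (ncX :: 'a ncp)" "bounded_deg 1 (ncY :: 'a ncp)"
      by (auto simp: bounded_deg_def ncX_def ncY_def)
    from xy(1) obtain a b i j where x: "bounded_deg i a" "bounded_deg j b"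
        "ncX = (\<lambda>w. ncmul f a w + ncmul g b w)"
      unfolding right_ideal2_def by blast
    from xy(2) obtain a' b' i' j' where y: "bounded_deg i' a'" "bounded_deg j' b'"
        "ncY = (\<lambda>w. ncmul f a' w + ncmul g b' w)"
      unfolding right_ideal2_def by blast
    note alt = leading_form_or_trivial_coefficient[OF f g le(2) d]
    \<comment> \<open>Otherwise both letters would be right multiples of \<open>g\<close> alone. So
      at least one of the two representations has a nontrivial coefficient at
      \<open>f\<close>.\<close>
    have "\<not> (a = (\<lambda>w. 0) \<and> a' = (\<lambda>w. 0))"
      using letters_not_in_principal_right_ideal[of g b b'] L2_Nil[OF g(1)] x(3) y(3) by auto
    then obtain c where "d = e" and c: "hcomp d f = (\<lambda>w. c * hcomp d g w)"
      using alt[OF x b1(1)] alt[OF y b1(2)] by blast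
    define f' where "f' = (\<lambda>w. f w - c * g w)"
    have f': "f' \<in> L2"
      using L2_add[OF f(1) L2_scale[OF g(1), of "- c"]] by (simp add: f'_def)
    have bf': "bounded_deg (d - 1) f'"
      unfolding bounded_deg_def
    proof (intro allI impI)
      fix w :: "bool list" assume "d - 1 < length w"
      then have "length w = d \<or> d < length w" using d by auto
      then show "f' w = 0"
        using f(2) g(2) fun_cong[OF c, of w] \<open>d = e\<close>
        by (auto simp: bounded_deg_def f'_def hcomp_def)
    qed
    have "d - 1 + e < m + n" using d le(1) by simp
    then have "bounded_deg 1 f' \<and> bounded_deg 1 g"
      using less.hyps[OF _ f' g(1) bf' g(2)] xy right_ideal2_shear[of f g c] unfolding f'_def
      by blast
    then show ?thesis by (auto simp: bounded_deg_def f'_def)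
  next
    case False
    then show ?thesis using f g le(2) by (auto simp: bounded_deg_def)
  qed
  have "g \<noteq> (\<lambda>w. 0)" "f \<noteq> (\<lambda>w. 0)"
    using nz[of f g] nz[of g f] less.prems by (simp_all add: right_ideal2_commute)
  then obtain d zf e zg where
    f: "bounded_deg d f" "length zf = d" "f zf \<noteq> 0" "d \<le> m" and
    g: "bounded_deg e g" "length zg = e" "g zg \<noteq> 0" "e \<le> n"
    using exact_degree[OF less.prems(3)] exact_degree[OF less.prems(4)] by metis
  show ?case
  proof (cases "e \<le> d")
    case True
    then show ?thesis
      using step[OF less.prems(1) f(1-3) less.prems(2) g(1-3)] f(4) g(4) less.prems(5,6) by simp
  next
    case False
    then show ?thesis
      using step[OF less.prems(2) g(1-3) less.prems(1) f(1-3)] f(4) g(4) less.prems(5,6)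
      by (simp add: right_ideal2_commute)
  qed
qed

lemma Lie_linear_form:
  assumes "f \<in> L2" "bounded_deg 1 f"
  shows "f = ncadd (ncsmul (f [True]) ncX) (ncsmul (f [False]) ncY)"
proof
  fix w
  consider "w = []" | "w = [True]" | "w = [False]" | "length w > 1"
    by (cases w; cases "tl w") auto
  then show "f w = ncadd (ncsmul (f [True]) ncX) (ncsmul (f [False]) ncY) w"
    using L2_Nil[OF assms(1)] assms(2)
    by cases (auto simp: ncadd_def ncsmul_def ncX_def ncY_def bounded_deg_def)
qed

section \<open>Lie automorphisms: linearity and the shape of the matrix\<close>

lemma lie_aut_in_right_ideal2:
  fixes \<xi> :: "'a::field ncp \<Rightarrow> 'a ncp"
  assumes "lie_aut_L2 \<xi>" "p \<in> L2"
  shows "\<xi> p \<in> right_ideal2 (\<xi> ncX) (\<xi> ncY)"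
  using assms(2)
proof (induction rule: L2.induct)
  case gen_x
  show ?case by (rule right_ideal2_left)
next
  case gen_y
  show ?case by (subst right_ideal2_commute) (rule right_ideal2_left)
next
  case (add p q)
  then show ?case
    using assms(1) right_ideal2_add by (auto simp: lie_aut_L2_def ncadd_def)
next
  case (smul p c)
  then show ?case
    using assms(1) right_ideal2_scale by (auto simp: lie_aut_L2_def ncsmul_def)
next
  case (br p q)
  have "\<xi> p \<in> L2" "\<xi> q \<in> L2"
    using br.hyps assms(1) by (auto simp: lie_aut_L2_def bij_betw_def)
  then obtain m n where mn: "bounded_deg m (\<xi> p)" "bounded_deg n (\<xi> q)"
    using L2_bounded_deg by blast
  \<comment> \<open>Each product has a left factor in the right ideal, and its right factor is a
    polynomial because it is a Lie element.\<close>
  have "\<xi> (ncbr p q) = (\<lambda>w. ncmul (\<xi> p) (\<xi> q) w + - 1 * ncmul (\<xi> q) (\<xi> p) w)"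
    using br.hyps assms(1) by (simp add: lie_aut_L2_def) (simp add: ncbr_def)
  then show ?case
    using right_ideal2_add[OF right_ideal2_mult[OF br.IH(1) mn(2)]
        right_ideal2_scale[OF right_ideal2_mult[OF br.IH(2) mn(1)], of "- 1"]] by simp
qed

text \<open>Surjectivity supplies preimages of x and y, which places both letters in the right ideal
  generated by their images.\<close>

lemma lie_aut_linear:
  fixes \<xi> :: "'a::field_char_0 ncp \<Rightarrow> 'a ncp"
  assumes "lie_aut_L2 \<xi>"
  shows "\<exists>a b c d. \<xi> ncX = ncadd (ncsmul a ncX) (ncsmul b ncY) \<and>
    \<xi> ncY = ncadd (ncsmul c ncX) (ncsmul d ncY)"
proof -
  have im: "\<xi> ` L2 = L2" using assms by (simp add: lie_aut_L2_def bij_betw_def)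
  then have fg: "\<xi> ncX \<in> L2" "\<xi> ncY \<in> L2" using L2.gen_x L2.gen_y by blast+
  have "ncX \<in> \<xi> ` L2" "ncY \<in> \<xi> ` L2" using im L2.gen_x L2.gen_y by auto
  then have "ncX \<in> right_ideal2 (\<xi> ncX) (\<xi> ncY)" "ncY \<in> right_ideal2 (\<xi> ncX) (\<xi> ncY)"
    using lie_aut_in_right_ideal2[OF assms] by fastforce+
  then show ?thesis
    using generating_pair_linear[OF fg] L2_bounded_deg[OF fg(1)] L2_bounded_deg[OF fg(2)]
      Lie_linear_form[OF fg(1)] Lie_linear_form[OF fg(2)] by metis
qed

theorem theorem2p4:
  fixes \<xi> :: "'a::field_char_0 ncp \<Rightarrow> 'a ncp"
  assumes "lie_aut_L2 \<xi>"
    and "\<xi> ` symmetric_L2 \<subseteq> symmetric_L2"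
  shows "\<exists>a b :: 'a. a\<^sup>2 - b\<^sup>2 \<noteq> 0
     \<and> \<xi> ncX = ncadd (ncsmul a ncX) (ncsmul b ncY)
     \<and> \<xi> ncY = ncadd (ncsmul b ncX) (ncsmul a ncY)
     \<and> inv_into L2 \<xi> ncX = ncadd (ncsmul (a / (a\<^sup>2 - b\<^sup>2)) ncX) (ncsmul (- b / (a\<^sup>2 - b\<^sup>2)) ncY)
     \<and> inv_into L2 \<xi> ncY = ncadd (ncsmul (- b / (a\<^sup>2 - b\<^sup>2)) ncX) (ncsmul (a / (a\<^sup>2 - b\<^sup>2)) ncY)"
proof -
  obtain a b c d where fx: "\<xi> ncX = ncadd (ncsmul a ncX) (ncsmul b ncY)"
    and fy: "\<xi> ncY = ncadd (ncsmul c ncX) (ncsmul d ncY)"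
    using lie_aut_linear[OF assms(1)] by blast
  have inj: "inj_on \<xi> L2"
    and add: "\<And>p q. p \<in> L2 \<Longrightarrow> q \<in> L2 \<Longrightarrow> \<xi> (ncadd p q) = ncadd (\<xi> p) (\<xi> q)"
    and smul: "\<And>k p. p \<in> L2 \<Longrightarrow> \<xi> (ncsmul k p) = ncsmul k (\<xi> p)"
    and br: "\<And>p q. p \<in> L2 \<Longrightarrow> q \<in> L2 \<Longrightarrow> \<xi> (ncbr p q) = ncbr (\<xi> p) (\<xi> q)"
    using assms(1) by (auto simp: lie_aut_L2_def bij_betw_def)
  have sym: "\<xi> p (map Not w) = \<xi> p w" if "p \<in> L2" "ncswap p = p" for p w
  proof -
    have "ncswap (\<xi> p) = \<xi> p" using assms(2) that by (auto simp: symmetric_L2_def)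
    then show ?thesis by (auto simp: ncswap_def dest: fun_cong[of _ _ w])
  qed
  note evals = ncadd_def ncsmul_def ncX_def ncY_def ncbr_def ncmul_Cons
  let ?X = "ncX :: 'a ncp" and ?Y = "ncY :: 'a ncp"
  \<comment> \<open>Two symmetric test elements, each yielding one linear equation for the matrix.
    The second is symmetric because the swap negates both [x,y] and x - y.\<close>
  let ?s = "ncadd ?X ?Y" and ?t = "ncbr (ncbr ?X ?Y) (ncadd ?X (ncsmul (- 1) ?Y))"
  have map_Not: "map Not w = v \<longleftrightarrow> w = map Not v" for w v
    by (auto simp: comp_def)
  have swap_br: "ncswap (ncbr p q) = ncbr (ncswap p) (ncswap q)" for p q :: "'a ncp"
    by (simp add: ncswap_def ncbr_def ncmul_def take_map drop_map)
  have swap_add: "ncswap (ncadd p q) = ncadd (ncswap p) (ncswap q)" for p q :: "'a ncp"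
    by (simp add: ncswap_def ncadd_def)
  have swap_smul: "ncswap (ncsmul k p) = ncsmul k (ncswap p)" for k and p :: "'a ncp"
    by (simp add: ncswap_def ncsmul_def)
  have swap_XY: "ncswap ?X = ?Y" "ncswap ?Y = ?X"
    by (auto simp: ncswap_def ncX_def ncY_def map_Not)
  have s: "?s \<in> L2" "ncswap ?s = ?s"
    by (auto intro: L2.intros simp: swap_add swap_XY) (simp add: ncadd_def add.commute)
  have neg: "ncbr (ncbr q p) (ncadd q (ncsmul (- 1) p)) = ncbr (ncbr p q) (ncadd p (ncsmul (- 1) q))"
    for p q :: "'a ncp"
  proof -
    have 1: "ncbr q p = (\<lambda>w. - 1 * ncbr p q w)"
      and 2: "ncadd q (ncsmul (- 1) p) = (\<lambda>w. - 1 * ncadd p (ncsmul (- 1) q) w)"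
      by (simp_all add: ncbr_def ncadd_def ncsmul_def)
    show ?thesis
      unfolding 1 2 unfolding ncbr_def[of "\<lambda>w. - 1 * _ w"] ncmul_linear
      by (simp add: ncbr_def[of "ncbr _ _"])
  qed
  have t: "?t \<in> L2" "ncswap ?t = ?t"
    by (auto intro: L2.intros simp: swap_add swap_XY swap_br swap_smul neg)
  have "\<xi> ?s [True] = \<xi> ?s [False]"
    using sym[OF s, of "[False]"] by simp
  then have e1: "a + c = b + d"
    unfolding add[OF L2.gen_x L2.gen_y] fx fy by (simp add: evals)
  define D where "D = a * d - b * c"
  have \<xi>t: "\<xi> ?t = ncbr (ncbr (\<xi> ?X) (\<xi> ?Y)) (ncadd (\<xi> ?X) (ncsmul (- 1) (\<xi> ?Y)))"
    by (simp add: br add smul L2.intros)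
  have brXY: "ncbr (\<xi> ?X) (\<xi> ?Y) = ncsmul D (ncbr ?X ?Y)"
  proof -
    have "ncbr (\<xi> ?X) (\<xi> ?Y) = (\<lambda>w. D * ncmul ?X ?Y w - D * ncmul ?Y ?X w)"
      unfolding fx fy ncbr_def ncadd_def ncsmul_def ncmul_linear D_def
      by (auto simp: algebra_simps)
    then show ?thesis by (simp add: ncsmul_def ncbr_def algebra_simps)
  qed
  \<comment> \<open>If the determinant vanished, \<xi> would send [x,y] to zero, contrary to
    injectivity; \<open>ncsmul 0 ?X\<close> represents zero as an element of
    \<open>L2\<close>.\<close>
  have D: "D \<noteq> 0"
  proof
    assume "D = 0"
    then have "\<xi> (ncbr ?X ?Y) = \<xi> (ncsmul 0 ?X)"
      using br[OF L2.gen_x L2.gen_y] smul[OF L2.gen_x, of 0] brXY by (simp add: ncsmul_def)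
    then have "ncbr ?X ?Y = ncsmul 0 ?X"
      using inj by (auto simp: inj_on_def intro: L2.intros)
    from fun_cong[OF this, of "[True, False]"] show False by (simp add: evals)
  qed
  \<comment> \<open>In [[x,y], \<alpha>x + \<beta>y] the coefficients at xyx and yxy are 2\<alpha>
    and -2\<beta>; here \<alpha> = a - c and \<beta> = b - d.\<close>
  have "\<xi> ?t [True, False, True] = \<xi> ?t [False, True, False]"
    using sym[OF t, of "[False, True, False]"] by simp
  then have "D * (2 * (a - c)) = D * (2 * (d - b))"
    unfolding \<xi>t brXY unfolding fx fy by (simp add: evals algebra_simps)
  then have e2: "a - c = d - b"
    using D by (simp del: right_diff_distrib_numeral)
  have "(a + c) + (a - c) = (b + d) + (d - b)" unfolding e1 e2 ..
  then have "2 * a = 2 * d" by (simp add: algebra_simps)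
  then have ad: "d = a" by simp
  then have bc: "c = b" using e1 by (simp add: add.commute)
  have nz: "a\<^sup>2 - b\<^sup>2 \<noteq> 0" using D by (simp add: D_def ad bc power2_eq_square)
  \<comment> \<open>Inverting \<xi> on linear forms becomes a 2 by 2 system for \<open>k\<close> and
    \<open>l\<close>, whose determinant is a^2 - b^2.\<close>
  have inv: "inv_into L2 \<xi> q = ncadd (ncsmul k ncX) (ncsmul l ncY)"
    if "q = ncadd (ncsmul (k * a + l * b) ncX) (ncsmul (k * b + l * a) ncY)" for k l q
  proof (rule inv_into_f_eq[OF inj])
    show "ncadd (ncsmul k ncX) (ncsmul l ncY) \<in> (L2 :: 'a ncp set)" by (intro L2.intros)
    show "\<xi> (ncadd (ncsmul k ncX) (ncsmul l ncY)) = q"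
      unfolding that by (simp add: add smul L2.intros fx fy ad bc)
        (simp add: ncadd_def ncsmul_def algebra_simps)
  qed
  have "a / (a\<^sup>2 - b\<^sup>2) * a + - b / (a\<^sup>2 - b\<^sup>2) * b = 1"
    "a / (a\<^sup>2 - b\<^sup>2) * b + - b / (a\<^sup>2 - b\<^sup>2) * a = 0"
    "- b / (a\<^sup>2 - b\<^sup>2) * a + a / (a\<^sup>2 - b\<^sup>2) * b = 0"
    "- b / (a\<^sup>2 - b\<^sup>2) * b + a / (a\<^sup>2 - b\<^sup>2) * a = 1"
    using nz by (simp_all add: power2_eq_square mult.commute flip: diff_divide_distrib)
  then have
    "inv_into L2 \<xi> ncX = ncadd (ncsmul (a / (a\<^sup>2 - b\<^sup>2)) ncX) (ncsmul (- b / (a\<^sup>2 - b\<^sup>2)) ncY)"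
    "inv_into L2 \<xi> ncY = ncadd (ncsmul (- b / (a\<^sup>2 - b\<^sup>2)) ncX) (ncsmul (a / (a\<^sup>2 - b\<^sup>2)) ncY)"
    by (intro inv; simp add: ncadd_def ncsmul_def)+
  then show ?thesis using nz fx fy ad bc by blast
qed

end
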